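(* Let $G$ and $H$ be graphs. The Cartesian product $G\,\Box\,H$ is sequentially distance preserving if and only if both $G$ and $H$ are sequentially distance preserving.
   Context: All graphs are finite, undirected and simple, with nonempty vertex set (except that deleting all vertices of a graph gives the empty graph, which is vacuously an isometric subgraph). The distance $d_G(u,v)$ is the minimum length (number of edges) of a path from $u$ to $v$ in $G$, and $d_G(u,v)=\infty$ if no such path exists. A subgraph $K$ of $G$ is isometric, written $K\le G$, if $d_K(u,v)=d_G(u,v)$ for every pair of vertices $u,v\in V(K)$. For a set $A$ of vertices, $G-A$ is the graph obtained from $G$ by deleting the vertices in $A$ (and all incident edges). A graph $G$ with $n$ vertices is sequentially distance preserving (sdp) if it is connected and there is an ordering $u_1,\dots,u_n$ of its vertices such that $G-\{u_i\}_{i=1}^s\le G$ for all $1\le s\le n$. The Cartesian product $G\,\Box\,H$ is the graph with vertex set $V(G)\times V(H)$ and edge set $E(G\,\Box\,H)=\{(u,x)(v,y) : (uv\in E(G)\text{ and }x=y),\text{ or }(xy\in E(H)\text{ and }u=v)\}$. *)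

theory Defs
  imports "Graph_Theory.Graph_Theory" "HOL-Library.Extended_Nat"
begin

text \<open>
  Finite simple undirected graphs are the finite, loop-free, symmetric digraphs without parallel
  arcs of Graph_Theory: an undirected edge is a pair of opposite arcs. The empty graph satisfies
  \<^locale>\<open>graph\<close> and \<^locale>\<open>pair_graph\<close>, but not \<^const>\<open>connected\<close>.
\<close>

text \<open>
  A path \<^term>\<open>p\<close> is a list of arcs without repeated vertices. The infimum over the empty set
  is \<^term>\<open>\<infinity> :: enat\<close>; over a nonempty set of paths it is attained.
\<close>
definition graph_dist :: "('a, 'b) pre_digraph \<Rightarrow> 'a \<Rightarrow> 'a \<Rightarrow> enat" where
  "graph_dist G u v = (INF p \<in> {p. pre_digraph.apath G u p v}. enat (length p))"

text \<open>
  \<^term>\<open>subgraph K G\<close> alone would also admit asymmetric arc sets, so \<^term>\<open>K\<close> is required to be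
  an undirected graph itself.
\<close>
definition isometric_subgraph :: "('a, 'b) pre_digraph \<Rightarrow> ('a, 'b) pre_digraph \<Rightarrow> bool" where
  "isometric_subgraph K G \<longleftrightarrow> graph K \<and> subgraph K G \<and>
    (\<forall>u \<in> verts K. \<forall>v \<in> verts K. graph_dist K u v = graph_dist G u v)"

definition delete_verts :: "('a, 'b) pre_digraph \<Rightarrow> 'a set \<Rightarrow> ('a, 'b) pre_digraph" where
  "delete_verts G A = G \<restriction> (verts G - A)"

definition sdp :: "('a, 'b) pre_digraph \<Rightarrow> bool" where
  "sdp G \<longleftrightarrow> connected G \<and>
    (\<exists>us. distinct us \<and> set us = verts G \<and>
      (\<forall>s. 1 \<le> s \<and> s \<le> length us \<longrightarrow>
        isometric_subgraph (delete_verts G (set (take s us))) G))"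

definition cartesian_product ::
  "'a pair_pre_digraph \<Rightarrow> 'b pair_pre_digraph \<Rightarrow> ('a \<times> 'b) pair_pre_digraph" where
  "cartesian_product G H = \<lparr>
    pverts = pverts G \<times> pverts H,
    parcs = {((u, x), (v, y)).
      (u, x) \<in> pverts G \<times> pverts H \<and> (v, y) \<in> pverts G \<times> pverts H \<and>
      ((u, v) \<in> parcs G \<and> x = y \<or> (x, y) \<in> parcs H \<and> u = v)} \<rparr>"

lemma pair_graph_cartesian_product:
  assumes "pair_graph G" "pair_graph H"
  shows "pair_graph (cartesian_product G H)"
proof -
  interpret G: pair_graph G by fact
  interpret H: pair_graph H by fact
  let ?P = "cartesian_product G H"
  have fin: "finite (pverts ?P)"
    by (simp add: cartesian_product_def G.pair_finite_verts H.pair_finite_verts)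
  have sub: "parcs ?P \<subseteq> pverts ?P \<times> pverts ?P"
    by (auto simp: cartesian_product_def)
  have fin_arcs: "finite (parcs ?P)"
    by (rule finite_subset[OF sub]) (use fin in simp)
  have sym: "sym (parcs ?P)"
    by (auto simp: cartesian_product_def sym_def intro: G.arcs_symmetric H.arcs_symmetric)
  have loopfree: "fst e \<noteq> snd e" if "e \<in> parcs ?P" for e
    using that by (auto simp: cartesian_product_def dest: G.no_loops' H.no_loops')
  show ?thesis
    using fin fin_arcs sym loopfree sub
    by unfold_locales (auto simp: symmetric_def)
qed

end

(* Deleting one vertex u from an induced subgraph preserves distances iff any two remaining
   neighbours of u are equal, adjacent or have another remaining common neighbour: a shortest path
   through u is rerouted through that neighbour. So sequential distance preservation is a local
   condition on a deletion order. A deletion order of the product restricts to a fibre over a vertex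
   of H, since distinct vertices of a fibre only have common neighbours inside it. Conversely,
   deleting the product lexicographically works: neighbours in the same fibre are handled by the
   factor, and neighbours in different fibres have the opposite corner of a square in common. *)
theory Submission
  imports Defs
begin

section \<open>Distances and powers of the adjacency relation\<close>

text \<open>If all path lengths exceed \<open>n\<close>, then \<open>Suc n\<close> is a lower bound
  of them. So a finite bound on the distance is always witnessed by a path, and \<infinity> needs no
  separate case.\<close>

lemma graph_dist_le_iff_apath:
  "graph_dist G u v \<le> enat n \<longleftrightarrow> (\<exists>p. pre_digraph.apath G u p v \<and> length p \<le> n)"
proof
  assume le: "graph_dist G u v \<le> enat n"
  show "\<exists>p. pre_digraph.apath G u p v \<and> length p \<le> n"
  proof (rule ccontr)
    assume "\<not> ?thesis"
    then have "enat (Suc n) \<le> graph_dist G u v"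
      unfolding graph_dist_def by (intro INF_greatest) (auto simp: not_le Suc_le_eq)
    then have "enat (Suc n) \<le> enat n"
      using le by (rule order_trans)
    then show False by simp
  qed
next
  assume "\<exists>p. pre_digraph.apath G u p v \<and> length p \<le> n"
  then obtain p where p: "pre_digraph.apath G u p v" "length p \<le> n" by blast
  have "graph_dist G u v \<le> enat (length p)"
    unfolding graph_dist_def by (rule INF_lower) (use p in simp)
  also have "\<dots> \<le> enat n" using p by simp
  finally show "graph_dist G u v \<le> enat n" .
qed

text \<open>Each round of \<open>awalk_to_apath\<close> cuts a closed subwalk \<open>r\<close> out
  of \<open>q @ r @ s\<close>.\<close>

lemma (in wf_digraph) length_awalk_to_apath:
  assumes "awalk u p v"
  shows "length (awalk_to_apath p) \<le> length p"
  using assms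
proof (induct rule: awalk_to_apath_induct)
  case (path p)
  then show ?case by (auto simp: awalk_to_apath.simps)
next
  case (decomp p q r s)
  have "length (q @ s) \<le> length p"
    using decomp by (auto elim!: awalk_cyc_decompE)
  then show ?case
    using decomp step_awalk_to_apath[of u p v q r s] by simp
qed

section \<open>Walks as powers of the adjacency relation\<close>

lemma (in wf_digraph) awalk_relpow:
  assumes "awalk u p v"
  shows "(u, v) \<in> arcs_ends G ^^ length p"
  using assms
proof (induct p arbitrary: u)
  case Nil
  then show ?case by (simp add: awalk_Nil_iff)
next
  case (Cons e p)
  then have "(u, head G e) \<in> arcs_ends G" "(head G e, v) \<in> arcs_ends G ^^ length p"
    by (auto simp: awalk_Cons_iff intro: in_arcs_imp_in_arcs_ends)
  then show ?case unfolding list.size(4) add_0_right add_Suc_right by (rule relpow_Suc_I2)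
qed

text \<open>Reflexive steps stand for waiting and are dropped from the walk, hence \<le> instead of
  equality.\<close>

lemma (in wf_digraph) reflcl_relpow_awalk:
  assumes "(u, v) \<in> ((arcs_ends G)\<^sup>=) ^^ n" "u \<in> verts G"
  shows "\<exists>p. awalk u p v \<and> length p \<le> n"
  using assms
proof (induct n arbitrary: u)
  case 0
  then show ?case by (auto simp: awalk_Nil_iff)
next
  case (Suc n)
  then obtain w where w: "(u, w) \<in> (arcs_ends G)\<^sup>=" "(w, v) \<in> ((arcs_ends G)\<^sup>=) ^^ n"
    by (meson relpow_Suc_D2)
  show ?case
  proof (cases "u = w")
    case True
    then show ?thesis using Suc w by (meson le_SucI)
  next
    case False
    then obtain e where e: "e \<in> arcs G" "tail G e = u" "head G e = w"
      using w by (auto simp: arcs_ends_conv)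
    then have "w \<in> verts G" by auto
    then obtain p where "awalk w p v" "length p \<le> n" using Suc w by blast
    then have "awalk u (e # p) v \<and> length (e # p) \<le> Suc n"
      using e by (auto simp: awalk_Cons_iff)
    then show ?thesis by blast
  qed
qed

lemma relpow_mono_rel:
  fixes r s :: "'a rel"
  assumes "r \<subseteq> s"
  shows "r ^^ n \<subseteq> s ^^ n"
  by (induct n) (use assms in auto)

text \<open>The missing steps are filled up by waiting.\<close>

lemma relpow_le_reflcl_relpow:
  assumes "(u, v) \<in> r ^^ m" "m \<le> n"
  shows "(u, v) \<in> (r\<^sup>=) ^^ n"
  using assms
proof (induct n arbitrary: m v)
  case 0
  then show ?case by simp
next
  case (Suc n)
  show ?case
  proof (cases m)
    case 0
    then have "(u, v) \<in> (r\<^sup>=) ^^ n" using Suc.hyps[of v 0] Suc.prems by simp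
    then show ?thesis by (auto intro: relpow_Suc_I)
  next
    case (Suc k)
    then obtain w where "(u, w) \<in> r ^^ k" "(w, v) \<in> r"
      using Suc.prems by (auto elim: relpow_Suc_E)
    then show ?thesis
      using Suc.hyps[of w k] Suc Suc.prems by (auto intro: relpow_Suc_I)
  qed
qed

text \<open>Taking the reflexive closure lets one power cover all lengths up to \<open>n\<close>.
  From here on distances are handled through such powers alone.\<close>

lemma (in wf_digraph) graph_dist_le_iff:
  assumes "u \<in> verts G"
  shows "graph_dist G u v \<le> enat n \<longleftrightarrow> (u, v) \<in> ((arcs_ends G)\<^sup>=) ^^ n"
proof
  assume "graph_dist G u v \<le> enat n"
  then obtain p where "awalk u p v" "length p \<le> n"
    by (auto simp: graph_dist_le_iff_apath apath_def)
  then show "(u, v) \<in> ((arcs_ends G)\<^sup>=) ^^ n"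
    by (meson awalk_relpow relpow_le_reflcl_relpow)
next
  assume "(u, v) \<in> ((arcs_ends G)\<^sup>=) ^^ n"
  then obtain p where "awalk u p v" "length p \<le> n"
    using reflcl_relpow_awalk assms by blast
  then show "graph_dist G u v \<le> enat n"
    by (meson graph_dist_le_iff_apath apath_awalk_to_apath length_awalk_to_apath order_trans)
qed

text \<open>Finite upper bounds determine a value: \<infinity> is the only one without any, and two
  finite values bound each other.\<close>

lemma enat_eq_iff_le: "a = b \<longleftrightarrow> (\<forall>n. a \<le> enat n \<longleftrightarrow> b \<le> enat n)"
  by (cases a; cases b) (auto intro: antisym)

section \<open>Distance-preserving vertex deletions\<close>

text \<open>Meant for \<open>S\<close> \<subseteq> \<open>T\<close>: isometry of the induced
  subgraphs. One implication suffices, since walks inside \<open>S\<close> are walks inside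
  \<open>T\<close>.\<close>

definition dist_preserving :: "'a rel \<Rightarrow> 'a set \<Rightarrow> 'a set \<Rightarrow> bool" where
  "dist_preserving E S T \<longleftrightarrow> (\<forall>u \<in> S. \<forall>v \<in> S. \<forall>n.
    (u, v) \<in> ((Restr E T)\<^sup>=) ^^ n \<longrightarrow> (u, v) \<in> ((Restr E S)\<^sup>=) ^^ n)"

lemma reflcl_Restr_relpow_mono:
  assumes "S \<subseteq> T"
  shows "((Restr E S)\<^sup>=) ^^ n \<subseteq> ((Restr E T)\<^sup>=) ^^ n"
  by (rule relpow_mono_rel) (use assms in auto)

lemma dist_preserving_refl: "dist_preserving E S S"
  by (simp add: dist_preserving_def)

lemma dist_preserving_trans:
  assumes "dist_preserving E S T" "dist_preserving E T U" "S \<subseteq> T"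
  shows "dist_preserving E S U"
  using assms unfolding dist_preserving_def by blast

text \<open>A walk inside \<open>T\<close> is also one inside \<open>U\<close>, so a smaller ambient
  set leaves fewer walks to replace.\<close>

lemma dist_preserving_subset:
  assumes "dist_preserving E S U" "T \<subseteq> U"
  shows "dist_preserving E S T"
  unfolding dist_preserving_def
proof (intro ballI allI impI)
  fix u v n
  assume uv: "u \<in> S" "v \<in> S" "(u, v) \<in> ((Restr E T)\<^sup>=) ^^ n"
  from uv(3) have "(u, v) \<in> ((Restr E U)\<^sup>=) ^^ n"
    by (rule subsetD[OF reflcl_Restr_relpow_mono[OF assms(2)]])
  then show "(u, v) \<in> ((Restr E S)\<^sup>=) ^^ n"
    using assms(1) uv unfolding dist_preserving_def by simp
qed

text \<open>The case \<open>n = 2\<close> of \<open>dist_preserving\<close> for walks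
  \<open>x\<close>, \<open>u\<close>, \<open>y\<close>: each must have a substitute of length at
  most two inside \<open>S\<close>.\<close>

definition removable :: "'a rel \<Rightarrow> 'a set \<Rightarrow> 'a \<Rightarrow> bool" where
  "removable E S u \<longleftrightarrow> (\<forall>x \<in> S. \<forall>y \<in> S. (x, u) \<in> E \<longrightarrow> (u, y) \<in> E \<longrightarrow>
    x = y \<or> (x, y) \<in> E \<or> (\<exists>w \<in> S. (x, w) \<in> E \<and> (w, y) \<in> E))"

lemma dist_preserving_insert_iff:
  assumes "u \<notin> S"
  shows "dist_preserving E S (insert u S) \<longleftrightarrow> removable E S u"
proof
  assume dp: "dist_preserving E S (insert u S)"
  show "removable E S u"
    unfolding removable_def
  proof (intro ballI impI)
    fix x y assume xy: "x \<in> S" "y \<in> S" "(x, u) \<in> E" "(u, y) \<in> E"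
    then have "(x, y) \<in> ((Restr E (insert u S))\<^sup>=) ^^ 2"
      by (auto simp: numeral_2_eq_2)
    then have "(x, y) \<in> ((Restr E S)\<^sup>=) ^^ 2"
      using dp xy unfolding dist_preserving_def by blast
    then show "x = y \<or> (x, y) \<in> E \<or> (\<exists>w \<in> S. (x, w) \<in> E \<and> (w, y) \<in> E)"
      by (auto simp: numeral_2_eq_2)
  qed
next
  assume rem: "removable E S u"
  let ?T = "(Restr E (insert u S))\<^sup>=" and ?S = "(Restr E S)\<^sup>="
  \<comment> \<open>Strong induction, because passing through \<open>u\<close> uses up two steps of
    the walk at once.\<close>
  have "(x, y) \<in> ?S ^^ n" if "(x, y) \<in> ?T ^^ n" "x \<in> S" "y \<in> S" for x y n
    using that
  proof (induct n arbitrary: x rule: less_induct)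
    case (less n)
    show ?case
    proof (cases n)
      case 0
      then show ?thesis using less.prems by simp
    next
      case (Suc k)
      then obtain z where z: "(x, z) \<in> ?T" "(z, y) \<in> ?T ^^ k"
        using less.prems by (meson relpow_Suc_D2)
      show ?thesis
      proof (cases "z \<in> S")
        case True
        then have "(x, z) \<in> ?S" "(z, y) \<in> ?S ^^ k"
          using z less Suc by auto
        then show ?thesis unfolding Suc by (rule relpow_Suc_I2)
      next
        case False
        then have [simp]: "z = u" and xu: "(x, u) \<in> E"
          using z less.prems by auto
        \<comment> \<open>The walk cannot stop at \<open>u\<close>, because \<open>y\<close> lies in
          \<open>S\<close> and \<open>u\<close> does not.\<close>
        obtain j where j: "k = Suc j"
          using z False less.prems by (cases k) auto
        then obtain t where t: "(u, t) \<in> ?T" "(t, y) \<in> ?T ^^ j"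
          using z by (metis \<open>z = u\<close> relpow_Suc_D2)
        \<comment> \<open>A saved step is spent waiting at \<open>x\<close>.\<close>
        have stay: "(x, y) \<in> ?S ^^ n" if "(x, y) \<in> ?S ^^ k"
          unfolding Suc using that by (rule relpow_Suc_I2[rotated]) simp
        show ?thesis
        proof (cases "t = u")
          \<comment> \<open>Waiting at \<open>u\<close> is skipped, which leaves a walk of length
            \<open>k\<close> for the induction hypothesis.\<close>
          case True
          then have "(x, y) \<in> ?T ^^ k"
            using t z less.prems unfolding j by (metis \<open>z = u\<close> relpow_Suc_I2)
          then show ?thesis using less Suc stay by blast
        next
          case False
          then have tS: "t \<in> S" and ut: "(u, t) \<in> E" using t by auto
          have ty: "(t, y) \<in> ?S ^^ j" using less Suc j t tS by simp
          \<comment> \<open>All three alternatives of \<open>removable\<close> give exactly two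
            steps of \<open>?S\<close> once waiting counts as a step.\<close>
          have "\<exists>w. (x, w) \<in> ?S \<and> (w, t) \<in> ?S"
            using rem xu ut tS less.prems unfolding removable_def by blast
          then show ?thesis
            unfolding Suc j using ty by (meson relpow_Suc_I2)
        qed
      qed
    qed
  qed
  then show "dist_preserving E S (insert u S)"
    unfolding dist_preserving_def by blast
qed

text \<open>The head goes first, so \<open>set us\<close> is what survives it. Each deletion is
  compared with the graph just before it, not with the original one.\<close>

primrec deletion_order :: "'a rel \<Rightarrow> 'a list \<Rightarrow> bool" where
  "deletion_order E [] \<longleftrightarrow> True"
| "deletion_order E (u # us) \<longleftrightarrow> removable E (set us) u \<and> deletion_order E us"

text \<open>Single deletions compose by transitivity. Conversely, isometry in the full graph passes
  to the ambient graph left after the first deletion.\<close>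

lemma deletion_order_iff_dist_preserving:
  assumes "distinct us"
  shows "deletion_order E us \<longleftrightarrow>
    (\<forall>s. 1 \<le> s \<and> s \<le> length us \<longrightarrow> dist_preserving E (set (drop s us)) (set us))"
  using assms
proof (induct us)
  case Nil
  then show ?case by auto
next
  case (Cons u us)
  have step: "removable E (set us) u \<longleftrightarrow> dist_preserving E (set us) (set (u # us))"
    using Cons.prems dist_preserving_insert_iff[of u "set us" E] by simp
  show ?case
  proof
    assume del: "deletion_order E (u # us)"
    show "\<forall>s. 1 \<le> s \<and> s \<le> length (u # us) \<longrightarrow>
      dist_preserving E (set (drop s (u # us))) (set (u # us))"
    proof (intro allI impI)
      fix s assume s: "1 \<le> s \<and> s \<le> length (u # us)"
      then obtain k where k: "s = Suc k" by (cases s) auto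
      \<comment> \<open>The induction hypothesis starts at one deletion, so \<open>k = 0\<close> is
        reflexivity.\<close>
      have "dist_preserving E (set (drop k us)) (set us)"
        using Cons del s k by (cases "k = 0") (auto simp: dist_preserving_refl)
      then show "dist_preserving E (set (drop s (u # us))) (set (u # us))"
        using dist_preserving_trans step del k by (metis deletion_order.simps(2) drop_Suc_Cons set_drop_subset)
    qed
  next
    assume dp: "\<forall>s. 1 \<le> s \<and> s \<le> length (u # us) \<longrightarrow>
      dist_preserving E (set (drop s (u # us))) (set (u # us))"
    have "dist_preserving E (set (drop k us)) (set (u # us))" if "k \<le> length us" for k
      using dp that by (metis Suc_le_mono drop_Suc_Cons le_add1 length_Cons plus_1_eq_Suc)
    \<comment> \<open>The case \<open>k = 0\<close> settles the head; for larger \<open>k\<close>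
      the ambient set shrinks to \<open>set us\<close>, as the induction hypothesis expects.\<close>
    from this[of 0] this have "dist_preserving E (set us) (set (u # us))"
      and "\<forall>k. 1 \<le> k \<and> k \<le> length us \<longrightarrow> dist_preserving E (set (drop k us)) (set us)"
      by (simp, meson dist_preserving_subset set_subset_Cons)
    then show "deletion_order E (u # us)"
      using Cons step by simp
  qed
qed

section \<open>Local characterisation of sequential distance preservation\<close>

lemma (in pair_graph) arcs_ends_induce:
  "arcs_ends (with_proj G \<restriction> S) = Restr (parcs G) S"
  by (auto simp: arcs_ends_conv)

text \<open>The empty \<open>S\<close> is included: it is what the last deletion leaves.\<close>

lemma (in pair_graph) graph_induce: "graph (with_proj G \<restriction> S)" if "S \<subseteq> pverts G"
proof -
  have "finite S" using that pair_finite_verts by (rule finite_subset)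
  moreover have "sym (Restr (parcs G) S)"
    by (auto simp: sym_def intro: arcs_symmetric)
  ultimately show ?thesis
    by unfold_locales
      (auto simp: arc_to_ends_def symmetric_def arcs_ends_induce pair_finite_arcs dest: no_loops')
qed

lemma (in pair_graph) isometric_subgraph_induce_iff:
  assumes "S \<subseteq> pverts G"
  shows "isometric_subgraph (with_proj G \<restriction> S) (with_proj G) \<longleftrightarrow>
    dist_preserving (parcs G) S (pverts G)"
proof -
  interpret S: graph "with_proj G \<restriction> S" by (rule graph_induce[OF assms])
  have sub: "subgraph (with_proj G \<restriction> S) (with_proj G)"
    by (rule subgraph_induce_subgraphI) (use assms in simp)
  \<comment> \<open>Makes the ambient relation in \<open>dist_preserving\<close> the full arc
    relation.\<close>
  have whole: "Restr (parcs G) (pverts G) = parcs G"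
    by (auto dest: wellformed')
  have le_S: "graph_dist (with_proj G \<restriction> S) u v \<le> enat n \<longleftrightarrow>
      (u, v) \<in> ((Restr (parcs G) S)\<^sup>=) ^^ n" if "u \<in> S" for u v n
    using S.graph_dist_le_iff[of u v n] that by (simp add: arcs_ends_induce)
  have le_G: "graph_dist (with_proj G) u v \<le> enat n \<longleftrightarrow> (u, v) \<in> ((parcs G)\<^sup>=) ^^ n"
    if "u \<in> S" for u v n
    using graph_dist_le_iff[of u v n] that assms by auto
  \<comment> \<open>Distances in a subgraph are never smaller, so equality amounts to one
    implication for every bound.\<close>
  have "((Restr (parcs G) S)\<^sup>=) ^^ n \<subseteq> ((parcs G)\<^sup>=) ^^ n" for n
    by (rule relpow_mono_rel) auto
  then have "graph_dist (with_proj G \<restriction> S) u v = graph_dist (with_proj G) u v \<longleftrightarrow>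
      (\<forall>n. (u, v) \<in> ((parcs G)\<^sup>=) ^^ n \<longrightarrow> (u, v) \<in> ((Restr (parcs G) S)\<^sup>=) ^^ n)"
    if "u \<in> S" for u v
    unfolding enat_eq_iff_le le_S[OF that] le_G[OF that] by (meson subsetD)
  then show ?thesis
    unfolding isometric_subgraph_def dist_preserving_def whole
    using S.graph_axioms sub by simp
qed

text \<open>Symmetric arcs make \<open>mk_symmetric\<close> change nothing, and walks starting at a
  vertex stay among the vertices.\<close>

lemma (in pair_graph) connected_iff_rtrancl:
  "connected (with_proj G) \<longleftrightarrow>
    pverts G \<noteq> {} \<and> (\<forall>u \<in> pverts G. \<forall>v \<in> pverts G. (u, v) \<in> (parcs G)\<^sup>*)"
proof -
  have "parcs (mk_symmetric (with_proj G)) = parcs G"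
    using adj_mk_symmetric_eq sym_arcs by simp
  moreover have "(u, v) \<in> rtrancl_on (pverts G) (parcs G) \<longleftrightarrow> (u, v) \<in> (parcs G)\<^sup>*"
    if "u \<in> pverts G" "v \<in> pverts G" for u v
    using that rtrancl_on_rtranclI[of u v] rtrancl_consistent_rtrancl_on[of u v "parcs G"]
      in_arcsD2 by metis
  ultimately show ?thesis
    by (auto simp: connected_def strongly_connected_def reachable_def)
qed

lemma (in pair_graph) sdp_iff_deletion_order:
  "sdp (with_proj G) \<longleftrightarrow> connected (with_proj G) \<and>
    (\<exists>us. distinct us \<and> set us = pverts G \<and> deletion_order (parcs G) us)"
proof -
  have "(\<forall>s. 1 \<le> s \<and> s \<le> length us \<longrightarrow>
      isometric_subgraph (delete_verts (with_proj G) (set (take s us))) (with_proj G)) \<longleftrightarrow>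
      deletion_order (parcs G) us"
    if us: "distinct us" "set us = pverts G" for us
  proof -
    have "set (take s us) \<union> set (drop s us) = pverts G" for s
      using us by (metis append_take_drop_id set_append)
    \<comment> \<open>By distinctness no deleted vertex reappears later in the list.\<close>
    then have "pverts G - set (take s us) = set (drop s us)" for s
      using us set_take_disj_set_drop_if_distinct[of us s s] by blast
    then have "isometric_subgraph (delete_verts (with_proj G) (set (take s us))) (with_proj G) \<longleftrightarrow>
        dist_preserving (parcs G) (set (drop s us)) (set us)" for s
      using isometric_subgraph_induce_iff[of "set (drop s us)"] us set_drop_subset[of s us]
      by (simp add: delete_verts_def)
    then show ?thesis
      by (simp only: deletion_order_iff_dist_preserving[OF us(1)])
  qed
  then show ?thesis unfolding sdp_def with_proj_simps by blast
qed

section \<open>Cartesian products\<close>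

lemma pverts_cartesian_product [simp]:
  "pverts (cartesian_product G H) = pverts G \<times> pverts H"
  by (simp add: cartesian_product_def)

lemma parcs_cartesian_product_iff:
  "((u, x), (v, y)) \<in> parcs (cartesian_product G H) \<longleftrightarrow>
    u \<in> pverts G \<and> x \<in> pverts H \<and> v \<in> pverts G \<and> y \<in> pverts H \<and>
    ((u, v) \<in> parcs G \<and> x = y \<or> (x, y) \<in> parcs H \<and> u = v)"
  by (auto simp: cartesian_product_def)

section \<open>From the product to its fibres\<close>

lemma deletion_order_fibre_fst:
  assumes "deletion_order (parcs (cartesian_product G H)) ps"
    and "set ps \<subseteq> pverts G \<times> pverts H" "x \<in> pverts H"
  shows "deletion_order (parcs G) (map fst (filter (\<lambda>p. snd p = x) ps))"
  using assms
proof (induct ps)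
  case Nil
  then show ?case by simp
next
  case (Cons p ps)
  let ?P = "parcs (cartesian_product G H)" and ?S = "fst ` {p \<in> set ps. snd p = x}"
  have "removable (parcs G) ?S (fst p)" if "snd p = x"
    unfolding removable_def
  proof (intro ballI impI)
    fix v v' assume v: "v \<in> ?S" "v' \<in> ?S" "(v, fst p) \<in> parcs G" "(fst p, v') \<in> parcs G"
    then have S: "(v, x) \<in> set ps" "(v', x) \<in> set ps" by auto
    have "((v, x), p) \<in> ?P" "(p, (v', x)) \<in> ?P"
      using v S that Cons.prems by (cases p; auto simp: parcs_cartesian_product_iff)+
    then have "(v, x) = (v', x) \<or> ((v, x), (v', x)) \<in> ?P \<or>
        (\<exists>w \<in> set ps. ((v, x), w) \<in> ?P \<and> (w, (v', x)) \<in> ?P)"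
      using Cons.prems S unfolding deletion_order.simps removable_def by blast
    \<comment> \<open>A common neighbour outside the fibre is entered and left along arcs of
      \<open>H\<close>; these fix the first coordinate, so \<open>v = v'\<close>.\<close>
    then show "v = v' \<or> (v, v') \<in> parcs G \<or> (\<exists>w \<in> ?S. (v, w) \<in> parcs G \<and> (w, v') \<in> parcs G)"
      by (force simp: parcs_cartesian_product_iff)
  qed
  then show ?case using Cons by auto
qed

text \<open>The mirror image: leaving this fibre and returning takes two arcs of \<open>G\<close>,
  which fix the second coordinate.\<close>

lemma deletion_order_fibre_snd:
  assumes "deletion_order (parcs (cartesian_product G H)) ps"
    and "set ps \<subseteq> pverts G \<times> pverts H" "u \<in> pverts G"
  shows "deletion_order (parcs H) (map snd (filter (\<lambda>p. fst p = u) ps))"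
  using assms
proof (induct ps)
  case Nil
  then show ?case by simp
next
  case (Cons p ps)
  let ?P = "parcs (cartesian_product G H)" and ?S = "snd ` {p \<in> set ps. fst p = u}"
  have "removable (parcs H) ?S (snd p)" if "fst p = u"
    unfolding removable_def
  proof (intro ballI impI)
    fix y y' assume y: "y \<in> ?S" "y' \<in> ?S" "(y, snd p) \<in> parcs H" "(snd p, y') \<in> parcs H"
    then have S: "(u, y) \<in> set ps" "(u, y') \<in> set ps" by auto
    have "((u, y), p) \<in> ?P" "(p, (u, y')) \<in> ?P"
      using y S that Cons.prems by (cases p; auto simp: parcs_cartesian_product_iff)+
    then have "(u, y) = (u, y') \<or> ((u, y), (u, y')) \<in> ?P \<or>
        (\<exists>w \<in> set ps. ((u, y), w) \<in> ?P \<and> (w, (u, y')) \<in> ?P)"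
      using Cons.prems S unfolding deletion_order.simps removable_def by blast
    then show "y = y' \<or> (y, y') \<in> parcs H \<or> (\<exists>w \<in> ?S. (y, w) \<in> parcs H \<and> (w, y') \<in> parcs H)"
      by (force simp: parcs_cartesian_product_iff)
  qed
  then show ?case using Cons by auto
qed

section \<open>From the factors to the product\<close>

lemma deletion_order_product:
  assumes "deletion_order (parcs G) us" "distinct us" "set us \<subseteq> pverts G"
    and H: "deletion_order (parcs H) xs" "distinct xs" "set xs \<subseteq> pverts H"
  shows "deletion_order (parcs (cartesian_product G H)) (List.product us xs)"
  using assms(1-3)
proof (induct us)
  case Nil
  then show ?case by simp
next
  case (Cons u us)
  let ?P = "parcs (cartesian_product G H)"
  have u: "removable (parcs G) (set us) u" "u \<notin> set us" "u \<in> pverts G" "set us \<subseteq> pverts G"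
    using Cons.prems by auto
  \<comment> \<open>Generalised to a partly deleted fibre over \<open>u\<close>, with
    \<open>ys\<close> still present, in front of the untouched fibres over
    \<open>us\<close>.\<close>
  have "deletion_order ?P (map (Pair u) ys @ List.product us xs)"
    if "deletion_order (parcs H) ys" "distinct ys" "set ys \<subseteq> set xs" for ys
    using that
  proof (induct ys)
    case Nil
    then show ?case using Cons by simp
  next
    case (Cons y ys)
    let ?S = "set (map (Pair u) ys @ List.product us xs)"
    have S: "p \<in> ?S \<longleftrightarrow> fst p = u \<and> snd p \<in> set ys \<or> fst p \<in> set us \<and> snd p \<in> set xs" for p
      by (cases p) auto
    have y: "removable (parcs H) (set ys) y" "y \<notin> set ys" "y \<in> set xs" "set ys \<subseteq> set xs"
      using Cons.prems by auto
    have "removable ?P ?S (u, y)"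
      unfolding removable_def
    proof (intro ballI impI)
      fix p q assume pq: "p \<in> ?S" "q \<in> ?S" "(p, (u, y)) \<in> ?P" "((u, y), q) \<in> ?P"
      obtain a b where p: "p = (a, b)" by (cases p)
      obtain c d where q: "q = (c, d)" by (cases q)
      \<comment> \<open>An arc of \<open>G\<close> cannot stay in the fibre over \<open>u\<close>
        since \<open>y\<close> is already gone from it, and an arc of \<open>H\<close> cannot leave
        that fibre since \<open>u\<close> is not in \<open>us\<close>.\<close>
      have P: "a = u \<and> b \<in> set ys \<and> (b, y) \<in> parcs H \<or> a \<in> set us \<and> b = y \<and> (a, u) \<in> parcs G"
        using pq u y unfolding S p by (auto simp: parcs_cartesian_product_iff)
      have Q: "c = u \<and> d \<in> set ys \<and> (y, d) \<in> parcs H \<or> c \<in> set us \<and> d = y \<and> (u, c) \<in> parcs G"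
        using pq u y unfolding S q by (auto simp: parcs_cartesian_product_iff)
      have arc: "((s, b'), (t, c')) \<in> ?P \<longleftrightarrow>
          (s, t) \<in> parcs G \<and> b' = c' \<or> (b', c') \<in> parcs H \<and> s = t"
        if "s \<in> insert u (set us)" "t \<in> insert u (set us)" "b' \<in> set xs" "c' \<in> set xs" for s t b' c'
        using that u H(3) by (auto simp: parcs_cartesian_product_iff)
      consider (HH) "a = u" "b \<in> set ys" "(b, y) \<in> parcs H" "c = u" "d \<in> set ys" "(y, d) \<in> parcs H"
        | (GG) "a \<in> set us" "b = y" "(a, u) \<in> parcs G" "c \<in> set us" "d = y" "(u, c) \<in> parcs G"
        | (HG) "a = u" "b \<in> set ys" "(b, y) \<in> parcs H" "c \<in> set us" "d = y" "(u, c) \<in> parcs G"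
        | (GH) "a \<in> set us" "b = y" "(a, u) \<in> parcs G" "c = u" "d \<in> set ys" "(y, d) \<in> parcs H"
        using P Q by blast
      then show "p = q \<or> (p, q) \<in> ?P \<or> (\<exists>w \<in> ?S. (p, w) \<in> ?P \<and> (w, q) \<in> ?P)"
      proof cases
        case HH
        then have "b = d \<or> (b, d) \<in> parcs H \<or>
            (\<exists>w \<in> set ys. (b, w) \<in> parcs H \<and> (w, d) \<in> parcs H)"
          using y unfolding removable_def by blast
        then show ?thesis
        proof (elim disjE bexE)
          fix w assume w: "w \<in> set ys" "(b, w) \<in> parcs H \<and> (w, d) \<in> parcs H"
          then have "(u, w) \<in> ?S" "(p, (u, w)) \<in> ?P" "((u, w), q) \<in> ?P"
            using HH y unfolding p q S by (auto simp: subset_iff arc)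
          then show ?thesis by blast
        qed (use HH y in \<open>auto simp: p q arc subset_iff\<close>)
      next
        case GG
        then have "a = c \<or> (a, c) \<in> parcs G \<or>
            (\<exists>w \<in> set us. (a, w) \<in> parcs G \<and> (w, c) \<in> parcs G)"
          using u unfolding removable_def by blast
        then show ?thesis
        proof (elim disjE bexE)
          fix w assume w: "w \<in> set us" "(a, w) \<in> parcs G \<and> (w, c) \<in> parcs G"
          then have "(w, y) \<in> ?S" "(p, (w, y)) \<in> ?P" "((w, y), q) \<in> ?P"
            using GG y unfolding p q S by (auto simp: arc)
          then show ?thesis by blast
        qed (use GG y in \<open>auto simp: p q arc subset_iff\<close>)
      next
        case HG
        \<comment> \<open>The corner opposite \<open>(u, y)\<close> in the square spanned by
          \<open>p\<close> and \<open>q\<close>. It survives because the fibre over \<open>c\<close>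
          is still complete.\<close>
        then have "(c, b) \<in> ?S" "(p, (c, b)) \<in> ?P" "((c, b), q) \<in> ?P"
          using y unfolding p q S by (auto simp: subset_iff arc)
        then show ?thesis by blast
      next
        case GH
        then have "(a, d) \<in> ?S" "(p, (a, d)) \<in> ?P" "((a, d), q) \<in> ?P"
          using y unfolding p q S by (auto simp: subset_iff arc)
        then show ?thesis by blast
      qed
    qed
    then show ?case using Cons by simp
  qed
  \<comment> \<open>For \<open>ys = xs\<close> the list is
    \<open>List.product (u # us) xs\<close>.\<close>
  from this[of xs] show ?case using H by simp
qed

section \<open>Connectedness of the product\<close>

lemma connected_cartesian_product_iff:
  assumes "pair_graph G" "pverts G \<noteq> {}" "pair_graph H" "pverts H \<noteq> {}"
  shows "connected (with_proj (cartesian_product G H)) \<longleftrightarrow>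
    connected (with_proj G) \<and> connected (with_proj H)"
proof -
  interpret G: pair_graph G by fact
  interpret H: pair_graph H by fact
  interpret P: pair_graph "cartesian_product G H"
    using assms by (intro pair_graph_cartesian_product)
  let ?P = "parcs (cartesian_product G H)"
  have proj: "(fst p, fst q) \<in> (parcs G)\<^sup>* \<and> (snd p, snd q) \<in> (parcs H)\<^sup>*"
    if "(p, q) \<in> ?P\<^sup>*" for p q
    using that
  proof induct
    case (step q r)
    \<comment> \<open>An arc of the product moves one coordinate while the other waits.\<close>
    then have "(fst q, fst r) \<in> (parcs G)\<^sup>=" "(snd q, snd r) \<in> (parcs H)\<^sup>="
      by (cases q; cases r; auto simp: parcs_cartesian_product_iff)+
    then show ?case using step by (auto intro: rtrancl_into_rtrancl)
  qed simp
  have fibre_G: "((u, x), (v, x)) \<in> ?P\<^sup>*" if "(u, v) \<in> (parcs G)\<^sup>*" "x \<in> pverts H" for u v x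
    using that
  proof induct
    case (step v w)
    then have "((v, x), (w, x)) \<in> ?P"
      by (auto simp: parcs_cartesian_product_iff dest: G.wellformed')
    then show ?case using step by (auto intro: rtrancl_into_rtrancl)
  qed simp
  have fibre_H: "((u, x), (u, y)) \<in> ?P\<^sup>*" if "(x, y) \<in> (parcs H)\<^sup>*" "u \<in> pverts G" for u x y
    using that
  proof induct
    case (step y z)
    then have "((u, y), (u, z)) \<in> ?P"
      by (auto simp: parcs_cartesian_product_iff dest: H.wellformed')
    then show ?case using step by (auto intro: rtrancl_into_rtrancl)
  qed simp
  show ?thesis
    unfolding P.connected_iff_rtrancl G.connected_iff_rtrancl H.connected_iff_rtrancl
  proof (intro iffI conjI ballI)
    assume conn: "pverts (cartesian_product G H) \<noteq> {} \<and>
      (\<forall>p \<in> pverts (cartesian_product G H). \<forall>q \<in> pverts (cartesian_product G H). (p, q) \<in> ?P\<^sup>*)"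
    \<comment> \<open>Any vertex of the nonempty graph \<open>H\<close> serves as second coordinate
      when lifting \<open>u\<close> and \<open>v\<close>.\<close>
    show "(u, v) \<in> (parcs G)\<^sup>*" if "u \<in> pverts G" "v \<in> pverts G" for u v
      using conn that assms(4) proj[of "(u, _)" "(v, _)"] by fastforce
    show "(x, y) \<in> (parcs H)\<^sup>*" if "x \<in> pverts H" "y \<in> pverts H" for x y
      using conn that assms(2) proj[of "(_, x)" "(_, y)"] by fastforce
  next
    fix p q
    assume conn: "(pverts G \<noteq> {} \<and> (\<forall>u \<in> pverts G. \<forall>v \<in> pverts G. (u, v) \<in> (parcs G)\<^sup>*)) \<and>
      pverts H \<noteq> {} \<and> (\<forall>u \<in> pverts H. \<forall>v \<in> pverts H. (u, v) \<in> (parcs H)\<^sup>*)"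
      and "p \<in> pverts (cartesian_product G H)" "q \<in> pverts (cartesian_product G H)"
    \<comment> \<open>First along \<open>G\<close> at height \<open>snd p\<close>, then along
      \<open>H\<close> over \<open>fst q\<close>.\<close>
    then show "(p, q) \<in> ?P\<^sup>*"
      using fibre_G[of "fst p" "fst q" "snd p"] fibre_H[of "snd p" "snd q" "fst q"]
      by (cases p; cases q) (auto intro: rtrancl_trans)
  qed (use assms in auto)
qed

theorem theorem4p4:
  fixes G :: "'a pair_pre_digraph" and H :: "'b pair_pre_digraph"
  assumes "pair_graph G" and "pverts G \<noteq> {}"
    and "pair_graph H" and "pverts H \<noteq> {}"
  shows "sdp (with_proj (cartesian_product G H)) \<longleftrightarrow>
    sdp (with_proj G) \<and> sdp (with_proj H)"
proof -
  interpret G: pair_graph G by fact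
  interpret H: pair_graph H by fact
  interpret P: pair_graph "cartesian_product G H"
    using assms by (intro pair_graph_cartesian_product)
  note sdp_iffs = P.sdp_iff_deletion_order G.sdp_iff_deletion_order H.sdp_iff_deletion_order
    connected_cartesian_product_iff[OF assms]
  \<comment> \<open>Base vertices that select one fibre of each kind.\<close>
  obtain u x where ux: "u \<in> pverts G" "x \<in> pverts H" using assms by blast
  show ?thesis
  proof
    assume sdp: "sdp (with_proj (cartesian_product G H))"
    then obtain ps where ps: "distinct ps" "set ps = pverts G \<times> pverts H"
        "deletion_order (parcs (cartesian_product G H)) ps"
      unfolding sdp_iffs by auto
    have fibres: "{p \<in> pverts G \<times> pverts H. snd p = x} = pverts G \<times> {x}"
        "{p \<in> pverts G \<times> pverts H. fst p = u} = {u} \<times> pverts H"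
      using ux by auto
    let ?us = "map fst (filter (\<lambda>p. snd p = x) ps)" and ?xs = "map snd (filter (\<lambda>p. fst p = u) ps)"
    \<comment> \<open>A projection is injective on the fibre it maps onto its factor, so no entry
      repeats.\<close>
    have "distinct ?us" "set ?us = pverts G" "deletion_order (parcs G) ?us"
      using ps ux deletion_order_fibre_fst[of G H ps x]
      by (auto simp: distinct_map inj_on_def fibres)
    moreover have "distinct ?xs" "set ?xs = pverts H" "deletion_order (parcs H) ?xs"
      using ps ux deletion_order_fibre_snd[of G H ps u]
      by (auto simp: distinct_map inj_on_def fibres)
    ultimately show "sdp (with_proj G) \<and> sdp (with_proj H)"
      using sdp unfolding sdp_iffs by blast
  next
    assume sdp: "sdp (with_proj G) \<and> sdp (with_proj H)"
    then obtain us xs where "distinct us" "set us = pverts G" "deletion_order (parcs G) us"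
        "distinct xs" "set xs = pverts H" "deletion_order (parcs H) xs"
      unfolding sdp_iffs by auto
    then have "distinct (List.product us xs)"
        "set (List.product us xs) = pverts (cartesian_product G H)"
        "deletion_order (parcs (cartesian_product G H)) (List.product us xs)"
      using deletion_order_product[of G us H xs] by (auto simp: distinct_product)
    then show "sdp (with_proj (cartesian_product G H))"
      using sdp unfolding sdp_iffs by blast
  qed
qed

end
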